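(* Let $(D,\dashv,\vdash,\alpha,\beta)$ be a regular BiHom-associative dialgebra. Then the bracket $$[x,y]=x\dashv y-\alpha^{-1}\beta(y)\vdash\alpha\beta^{-1}(x)\qquad(x,y\in D)$$ makes $(D,[\cdot,\cdot],\alpha,\beta)$ a BiHom-Leibniz algebra.
   Context: All vector spaces are over a fixed field. A BiHom-associative dialgebra is a tuple $(A,\dashv,\vdash,\alpha,\beta)$ consisting of a vector space $A$, bilinear maps $\dashv,\vdash:A\times A\to A$ and linear maps $\alpha,\beta:A\to A$ such that $\alpha\circ\beta=\beta\circ\alpha$ and, for all $x,y,z\in A$: (i) $(x\dashv y)\dashv\beta(z)=\alpha(x)\dashv(y\dashv z)$; (ii) $(x\dashv y)\dashv\beta(z)=\alpha(x)\dashv(y\vdash z)$; (iii) $(x\vdash y)\dashv\beta(z)=\alpha(x)\vdash(y\dashv z)$; (iv) $(x\dashv y)\vdash\beta(z)=\alpha(x)\vdash(y\vdash z)$; (v) $(x\vdash y)\vdash\beta(z)=\alpha(x)\vdash(y\vdash z)$. It is regular if $\alpha$ and $\beta$ are bijective and preserve both products $\dashv$ and $\vdash$. A (right) BiHom-Leibniz algebra is $(L,[\cdot,\cdot],\alpha,\beta)$ with $L$ a vector space, $[\cdot,\cdot]:L\times L\to L$ bilinear and $\alpha,\beta:L\to L$ linear such that $[[x,y],\alpha\beta(z)]=[[x,\beta(z)],\alpha(y)]+[\alpha(x),[y,\alpha(z)]]$ for all $x,y,z\in L$. *)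

theory Defs
  imports Complex_Main
begin

definition bilinear_map ::
  "('k::field \<Rightarrow> 'a::ab_group_add \<Rightarrow> 'a) \<Rightarrow> ('a \<Rightarrow> 'a \<Rightarrow> 'a) \<Rightarrow> bool"
  where "bilinear_map scale f \<longleftrightarrow>
    (\<forall>x. Vector_Spaces.linear scale scale (\<lambda>y. f x y)) \<and>
    (\<forall>y. Vector_Spaces.linear scale scale (\<lambda>x. f x y))"

locale bihom_associative_dialgebra = vector_space scale
  for scale :: "'k::field \<Rightarrow> 'a::ab_group_add \<Rightarrow> 'a" +
  fixes left_prod :: "'a \<Rightarrow> 'a \<Rightarrow> 'a" (infixl "\<stileturn>" 70)
    and right_prod :: "'a \<Rightarrow> 'a \<Rightarrow> 'a" (infixl "\<turnstile>" 70)
    and \<alpha> :: "'a \<Rightarrow> 'a"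
    and \<beta> :: "'a \<Rightarrow> 'a"
  assumes bilinear_left: "bilinear_map scale (\<stileturn>)"
    and bilinear_right: "bilinear_map scale (\<turnstile>)"
    and linear_alpha: "Vector_Spaces.linear scale scale \<alpha>"
    and linear_beta: "Vector_Spaces.linear scale scale \<beta>"
    and alpha_beta_commute: "\<alpha> \<circ> \<beta> = \<beta> \<circ> \<alpha>"
    and left_left: "(x \<stileturn> y) \<stileturn> \<beta> z = \<alpha> x \<stileturn> (y \<stileturn> z)"
    and left_left_right: "(x \<stileturn> y) \<stileturn> \<beta> z = \<alpha> x \<stileturn> (y \<turnstile> z)"
    and right_left: "(x \<turnstile> y) \<stileturn> \<beta> z = \<alpha> x \<turnstile> (y \<stileturn> z)"
    and left_right_right: "(x \<stileturn> y) \<turnstile> \<beta> z = \<alpha> x \<turnstile> (y \<turnstile> z)"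
    and right_right: "(x \<turnstile> y) \<turnstile> \<beta> z = \<alpha> x \<turnstile> (y \<turnstile> z)"

locale regular_bihom_associative_dialgebra = bihom_associative_dialgebra +
  assumes bij_alpha: "bij \<alpha>"
    and bij_beta: "bij \<beta>"
    and alpha_left: "\<alpha> (x \<stileturn> y) = \<alpha> x \<stileturn> \<alpha> y"
    and alpha_right: "\<alpha> (x \<turnstile> y) = \<alpha> x \<turnstile> \<alpha> y"
    and beta_left: "\<beta> (x \<stileturn> y) = \<beta> x \<stileturn> \<beta> y"
    and beta_right: "\<beta> (x \<turnstile> y) = \<beta> x \<turnstile> \<beta> y"

(* Right BiHom-Leibniz algebra; commutation of \<alpha> and \<beta> and multiplicativity
   of the two maps are not part of the notion. *)
locale bihom_leibniz_algebra = vector_space scale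
  for scale :: "'k::field \<Rightarrow> 'a::ab_group_add \<Rightarrow> 'a" +
  fixes bracket :: "'a \<Rightarrow> 'a \<Rightarrow> 'a"
    and \<alpha> :: "'a \<Rightarrow> 'a"
    and \<beta> :: "'a \<Rightarrow> 'a"
  assumes bilinear_bracket: "bilinear_map scale bracket"
    and linear_alpha: "Vector_Spaces.linear scale scale \<alpha>"
    and linear_beta: "Vector_Spaces.linear scale scale \<beta>"
    and leibniz: "bracket (bracket x y) (\<alpha> (\<beta> z)) =
      bracket (bracket x (\<beta> z)) (\<alpha> y) + bracket (\<alpha> x) (bracket y (\<alpha> z))"

end

theory Submission
  imports Defs
begin

text \<open>
  The theorem is Loday's observation that \<open>x \<stileturn> y - y \<turnstile> x\<close> is a Leibniz bracket on every
  associative dialgebra, transported along Yau's twisting. In the regular case the structure maps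
  can be divided out: the products \<open>x \<stileturn>\<^sub>0 y = \<alpha>\<^sup>-\<^sup>1 x \<stileturn> \<beta>\<^sup>-\<^sup>1 y\<close> and
  \<open>x \<turnstile>\<^sub>0 y = \<alpha>\<^sup>-\<^sup>1 x \<turnstile> \<beta>\<^sup>-\<^sup>1 y\<close> form an ordinary associative dialgebra (\<open>untwisted_dialgebra\<close>),
  for which \<open>\<alpha>\<close> and \<open>\<beta>\<close> are endomorphisms. Since \<open>\<alpha>\<close> and \<open>\<beta>\<close> commute,
  \<open>\<alpha>\<^sup>-\<^sup>1 (\<beta> y) \<turnstile> \<alpha> (\<beta>\<^sup>-\<^sup>1 x) = \<beta> y \<turnstile>\<^sub>0 \<alpha> x\<close>, so the given bracket is
  \<open>[x, y] = [\<alpha> x, \<beta> y]\<^sub>0\<close>, where \<open>[_, _]\<^sub>0\<close> is Loday's bracket of the untwisted products.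
  All three terms of the BiHom-Leibniz identity at \<open>x, y, z\<close> are then the corresponding terms of
  the Leibniz identity for \<open>[_, _]\<^sub>0\<close> at \<open>\<alpha>\<^sup>2 x\<close>, \<open>\<alpha> \<beta> y\<close>, \<open>\<alpha> \<beta>\<^sup>2 z\<close>.
\<close>

text \<open>
  An associative dialgebra in the sense of Loday. Only biadditivity of the products matters for the
  Leibniz identity, so no scalars are involved.
\<close>

locale associative_dialgebra =
  fixes left_prod :: "'a::ab_group_add \<Rightarrow> 'a \<Rightarrow> 'a" (infixl "\<stileturn>" 70)
    and right_prod :: "'a \<Rightarrow> 'a \<Rightarrow> 'a" (infixl "\<turnstile>" 70)
  assumes left_diff_left: "(x - y) \<stileturn> z = x \<stileturn> z - y \<stileturn> z"
    and left_diff_right: "x \<stileturn> (y - z) = x \<stileturn> y - x \<stileturn> z"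
    and right_diff_left: "(x - y) \<turnstile> z = x \<turnstile> z - y \<turnstile> z"
    and right_diff_right: "x \<turnstile> (y - z) = x \<turnstile> y - x \<turnstile> z"
    and assoc_left_left: "x \<stileturn> (y \<stileturn> z) = (x \<stileturn> y) \<stileturn> z"
    and assoc_left_right: "x \<stileturn> (y \<turnstile> z) = (x \<stileturn> y) \<stileturn> z"
    and assoc_mixed: "(x \<turnstile> y) \<stileturn> z = x \<turnstile> (y \<stileturn> z)"
    and assoc_right_left: "(x \<stileturn> y) \<turnstile> z = x \<turnstile> (y \<turnstile> z)"
    and assoc_right_right: "(x \<turnstile> y) \<turnstile> z = x \<turnstile> (y \<turnstile> z)"
begin

text \<open>The Leibniz bracket that replaces the commutator when the two products differ.\<close>

definition loday_bracket :: "'a \<Rightarrow> 'a \<Rightarrow> 'a"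
  where "loday_bracket x y = x \<stileturn> y - y \<turnstile> x"

lemma loday_bracket_leibniz:
  "loday_bracket (loday_bracket x y) z =
    loday_bracket (loday_bracket x z) y + loday_bracket x (loday_bracket y z)"
  by (simp add: loday_bracket_def left_diff_left left_diff_right right_diff_left right_diff_right
      assoc_left_left assoc_left_right assoc_mixed assoc_right_left assoc_right_right)

end

lemma bilinear_map_linear:
  assumes "bilinear_map scale f"
  shows "Vector_Spaces.linear scale scale (\<lambda>y. f x y)"
    and "Vector_Spaces.linear scale scale (\<lambda>x. f x y)"
  using assms by (simp_all add: bilinear_map_def)

lemma bilinear_map_diff:
  assumes "bilinear_map scale f"
  shows "f (x - y) z = f x z - f y z" and "f x (y - z) = f x y - f x z"
  using module_hom.diff[OF Vector_Spaces.linear.axioms(3)[OF bilinear_map_linear(2)[OF assms]]]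
    module_hom.diff[OF Vector_Spaces.linear.axioms(3)[OF bilinear_map_linear(1)[OF assms]]]
  by blast+

lemma bilinear_map_flip:
  assumes "bilinear_map scale f"
  shows "bilinear_map scale (\<lambda>x y. f y x)"
  using assms by (simp add: bilinear_map_def)

lemma bilinear_map_compose_linear:
  assumes f: "bilinear_map scale f"
    and g: "Vector_Spaces.linear scale scale g" and h: "Vector_Spaces.linear scale scale h"
  shows "bilinear_map scale (\<lambda>x y. f (g x) (h y))"
  unfolding bilinear_map_def
  using Vector_Spaces.linear_compose[OF h bilinear_map_linear(1)[OF f]]
    Vector_Spaces.linear_compose[OF g bilinear_map_linear(2)[OF f]]
  by (simp add: o_def)

lemma (in vector_space) bilinear_map_minus:
  assumes "bilinear_map scale f" and "bilinear_map scale g"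
  shows "bilinear_map scale (\<lambda>x y. f x y - g x y)"
proof -
  interpret vector_space_pair scale scale ..
  show ?thesis
    using assms by (simp add: bilinear_map_def linear_compose_sub)
qed

lemma (in vector_space) linear_inv_of_bij:
  assumes "Vector_Spaces.linear scale scale g" and "bij g"
  shows "Vector_Spaces.linear scale scale (inv g)"
proof -
  interpret g: Vector_Spaces.linear scale scale g by fact
  have "inv g (x + y) = inv g x + inv g y" and "inv g (scale c x) = scale c (inv g x)" for x y c
    using \<open>bij g\<close>
    by (metis bij_inv_eq_iff g.add, metis bij_inv_eq_iff g.scale)
  then show ?thesis
    by unfold_locales auto
qed

context regular_bihom_associative_dialgebra
begin

text \<open>
  The untwisted products: \<open>x \<stileturn> y = \<alpha> x \<stileturn>\<^sub>0 \<beta> y\<close> and \<open>x \<turnstile> y = \<alpha> x \<turnstile>\<^sub>0 \<beta> y\<close>, which determines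
  \<open>\<stileturn>\<^sub>0\<close> and \<open>\<turnstile>\<^sub>0\<close> because \<open>\<alpha>\<close> and \<open>\<beta>\<close> are bijective.
\<close>

definition untwisted_left :: "'b \<Rightarrow> 'b \<Rightarrow> 'b" (infixl "\<stileturn>\<^sub>0" 70)
  where "x \<stileturn>\<^sub>0 y = inv \<alpha> x \<stileturn> inv \<beta> y"

definition untwisted_right :: "'b \<Rightarrow> 'b \<Rightarrow> 'b" (infixl "\<turnstile>\<^sub>0" 70)
  where "x \<turnstile>\<^sub>0 y = inv \<alpha> x \<turnstile> inv \<beta> y"

lemma inv_simps [simp]:
  "inv \<alpha> (\<alpha> x) = x" "inv \<beta> (\<beta> x) = x" "\<alpha> (inv \<alpha> x) = x" "\<beta> (inv \<beta> x) = x"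
  using bij_alpha bij_beta by (simp_all add: bij_is_inj bij_is_surj surj_f_inv_f)

lemma beta_alpha: "\<beta> (\<alpha> x) = \<alpha> (\<beta> x)"
  using alpha_beta_commute by (metis comp_apply)

lemma inv_alpha_beta: "inv \<alpha> (\<beta> x) = \<beta> (inv \<alpha> x)"
  by (metis inv_simps(1,3) beta_alpha)

lemma inv_beta_alpha: "inv \<beta> (\<alpha> x) = \<alpha> (inv \<beta> x)"
  by (metis inv_simps(2,4) beta_alpha)

lemma alpha_untwisted:
  "\<alpha> (x \<stileturn>\<^sub>0 y) = \<alpha> x \<stileturn>\<^sub>0 \<alpha> y" "\<alpha> (x \<turnstile>\<^sub>0 y) = \<alpha> x \<turnstile>\<^sub>0 \<alpha> y"
  by (simp_all add: untwisted_left_def untwisted_right_def alpha_left alpha_right inv_beta_alpha)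

lemma beta_untwisted:
  "\<beta> (x \<stileturn>\<^sub>0 y) = \<beta> x \<stileturn>\<^sub>0 \<beta> y" "\<beta> (x \<turnstile>\<^sub>0 y) = \<beta> x \<turnstile>\<^sub>0 \<beta> y"
  by (simp_all add: untwisted_left_def untwisted_right_def beta_left beta_right inv_alpha_beta)

lemma products_untwisted: "x \<stileturn> y = \<alpha> x \<stileturn>\<^sub>0 \<beta> y" "x \<turnstile> y = \<alpha> x \<turnstile>\<^sub>0 \<beta> y"
  by (simp_all add: untwisted_left_def untwisted_right_def)

lemma untwisted_dialgebra: "associative_dialgebra (\<stileturn>\<^sub>0) (\<turnstile>\<^sub>0)"
proof -
  have inv_lin: "Vector_Spaces.linear scale scale (inv \<alpha>)"
    "Vector_Spaces.linear scale scale (inv \<beta>)"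
    by (intro linear_inv_of_bij linear_alpha linear_beta bij_alpha bij_beta)+
  have "bilinear_map scale (\<stileturn>\<^sub>0)" "bilinear_map scale (\<turnstile>\<^sub>0)"
    using bilinear_map_compose_linear[OF bilinear_left inv_lin]
      bilinear_map_compose_linear[OF bilinear_right inv_lin]
    by (simp_all add: untwisted_left_def[abs_def] untwisted_right_def[abs_def])
  note diffs = bilinear_map_diff[OF this(1)] bilinear_map_diff[OF this(2)]
  \<comment> \<open>Every triple has the form below, and then the untwisted axioms at \<open>x, y, z\<close>
    are the twisted ones at \<open>u, v, w\<close>.\<close>
  have triple: "\<exists>u v w. x = \<alpha> (\<alpha> u) \<and> y = \<alpha> (\<beta> v) \<and> z = \<beta> (\<beta> w)" for x y z
    by (metis inv_simps(3,4))
  show ?thesis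
  proof (unfold_locales, goal_cases)
    case (5 x y z)
    with triple[of x y z] left_left show ?case
      by (auto simp: products_untwisted alpha_untwisted beta_untwisted beta_alpha)
  next
    case (6 x y z)
    with triple[of x y z] left_left_right show ?case
      by (auto simp: products_untwisted alpha_untwisted beta_untwisted beta_alpha)
  next
    case (7 x y z)
    with triple[of x y z] right_left show ?case
      by (auto simp: products_untwisted alpha_untwisted beta_untwisted beta_alpha)
  next
    case (8 x y z)
    with triple[of x y z] left_right_right show ?case
      by (auto simp: products_untwisted alpha_untwisted beta_untwisted beta_alpha)
  next
    case (9 x y z)
    with triple[of x y z] right_right show ?case
      by (auto simp: products_untwisted alpha_untwisted beta_untwisted beta_alpha)
  qed (rule diffs)+
qed

sublocale untwisted: associative_dialgebra "(\<stileturn>\<^sub>0)" "(\<turnstile>\<^sub>0)"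
  by (rule untwisted_dialgebra)

lemma alpha_bracket:
  "\<alpha> (untwisted.loday_bracket x y) = untwisted.loday_bracket (\<alpha> x) (\<alpha> y)"
  using module_hom.diff[OF Vector_Spaces.linear.axioms(3)[OF linear_alpha]]
  by (simp add: untwisted.loday_bracket_def alpha_untwisted)

lemma beta_bracket:
  "\<beta> (untwisted.loday_bracket x y) = untwisted.loday_bracket (\<beta> x) (\<beta> y)"
  using module_hom.diff[OF Vector_Spaces.linear.axioms(3)[OF linear_beta]]
  by (simp add: untwisted.loday_bracket_def beta_untwisted)

lemma bracket_untwisted:
  "x \<stileturn> y - inv \<alpha> (\<beta> y) \<turnstile> \<alpha> (inv \<beta> x) = untwisted.loday_bracket (\<alpha> x) (\<beta> y)"
  by (simp add: untwisted.loday_bracket_def products_untwisted beta_alpha)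

lemma bracket_bihom_leibniz:
  "bihom_leibniz_algebra scale (\<lambda>x y. x \<stileturn> y - inv \<alpha> (\<beta> y) \<turnstile> \<alpha> (inv \<beta> x)) \<alpha> \<beta>"
  (is "bihom_leibniz_algebra scale ?br \<alpha> \<beta>")
proof (intro bihom_leibniz_algebra.intro bihom_leibniz_algebra_axioms.intro)
  have inv_lin: "Vector_Spaces.linear scale scale (\<lambda>y. inv \<alpha> (\<beta> y))"
    "Vector_Spaces.linear scale scale (\<lambda>x. \<alpha> (inv \<beta> x))"
    using Vector_Spaces.linear_compose[OF linear_beta linear_inv_of_bij[OF linear_alpha bij_alpha]]
      Vector_Spaces.linear_compose[OF linear_inv_of_bij[OF linear_beta bij_beta] linear_alpha]
    by (simp_all add: o_def)
  show "bilinear_map scale ?br"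
    by (intro bilinear_map_minus bilinear_left
        bilinear_map_flip[OF bilinear_map_compose_linear[OF bilinear_right inv_lin]])
next
  fix x y z
  show "?br (?br x y) (\<alpha> (\<beta> z)) = ?br (?br x (\<beta> z)) (\<alpha> y) + ?br (\<alpha> x) (?br y (\<alpha> z))"
    using untwisted.loday_bracket_leibniz[of "\<alpha> (\<alpha> x)" "\<alpha> (\<beta> y)" "\<alpha> (\<beta> (\<beta> z))"]
    unfolding bracket_untwisted by (simp only: alpha_bracket beta_bracket beta_alpha)
qed (fact vector_space_axioms linear_alpha linear_beta)+

end

theorem theorem2p46:
  fixes scale :: "'k::field \<Rightarrow> 'a::ab_group_add \<Rightarrow> 'a"
    and left_prod :: "'a \<Rightarrow> 'a \<Rightarrow> 'a" (infixl "\<stileturn>" 70)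
    and right_prod :: "'a \<Rightarrow> 'a \<Rightarrow> 'a" (infixl "\<turnstile>" 70)
    and \<alpha> \<beta> :: "'a \<Rightarrow> 'a"
  assumes "regular_bihom_associative_dialgebra scale (\<stileturn>) (\<turnstile>) \<alpha> \<beta>"
  shows "bihom_leibniz_algebra scale
    (\<lambda>x y. (x \<stileturn> y) - (inv \<alpha> (\<beta> y) \<turnstile> \<alpha> (inv \<beta> x))) \<alpha> \<beta>"
  using assms by (rule regular_bihom_associative_dialgebra.bracket_bihom_leibniz)

end
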